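(* The problem of computing $\operatorname{DMCES}(G,G')$ for finite node-labeled digraphs $G=(V,\mathcal D,\ell_v)$ and $G'=(V',\mathcal D',\ell'_v)$ that are weakly connected, simple and oriented can be reduced to the maximum clique finding problem in time polynomial in the number of nodes of $G$ and $G'$; that is, there is an algorithm running in time polynomial in $|V|+|V'|$ that constructs from $G,G'$ a finite unlabeled undirected graph whose maximum clique size equals $\operatorname{DMCES}(G,G')$.
   Context: A node-labeled digraph $G=(V,\mathcal D,\ell_v)$ consists of a finite node set $V$, directed edges $\mathcal D\subseteq V\times V$, and a node-labeling function $\ell_v$ on $V$. Weakly connected: the underlying undirected graph is connected. Simple: no self-loops and no parallel edges with the same source and target. Oriented: no pair $(u,v),(v,u)$ both in $\mathcal D$. A feasible solution is a pair $(U,\phi)$ with $U\subseteq V$ and $\phi:U\to V'$ injective with $\ell'_v(\phi(u))=\ell_v(u)$ for all $u\in U$; its score is $\mathcal P(U,\phi)=|\{(v_1,v_2)\in U\times U:(v_1,v_2)\in\mathcal D,\ (\phi(v_1),\phi(v_2))\in\mathcal D'\}|$; $\operatorname{DMCES}(G,G')$ is the maximum score over feasible solutions. A clique is a set of pairwise adjacent nodes. *)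

theory Defs
  imports "Graph_Theory.Graph_Theory" "HOL-Computational_Algebra.Polynomial"
begin

section \<open>Node-labeled digraphs and DMCES\<close>

text \<open>
  A node-labeled digraph is a \<^typ>\<open>'a pair_pre_digraph\<close> together with a labeling function on its
  nodes. The arcs are a set of pairs, so parallel arcs cannot occur, and \<^const>\<open>pair_digraph\<close> says
  that the digraph is well-formed, finite and free of loops.
\<close>

definition oriented :: "'a pair_pre_digraph \<Rightarrow> bool" where
  "oriented G \<longleftrightarrow> (\<forall>u v. \<not> ((u, v) \<in> parcs G \<and> (v, u) \<in> parcs G))"

definition weakly_connected :: "'a pair_pre_digraph \<Rightarrow> bool" where
  "weakly_connected G \<longleftrightarrow> Digraph_Component.connected (with_proj G)"

definition feasible ::
  "'a pair_pre_digraph \<Rightarrow> ('a \<Rightarrow> 'l) \<Rightarrow> 'b pair_pre_digraph \<Rightarrow> ('b \<Rightarrow> 'l) \<Rightarrow> 'a set \<Rightarrow> ('a \<Rightarrow> 'b) \<Rightarrow> bool"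
where
  "feasible G lab G' lab' U \<phi> \<longleftrightarrow>
     U \<subseteq> pverts G \<and> \<phi> ` U \<subseteq> pverts G' \<and> inj_on \<phi> U \<and> (\<forall>u\<in>U. lab' (\<phi> u) = lab u)"

definition score ::
  "'a pair_pre_digraph \<Rightarrow> 'b pair_pre_digraph \<Rightarrow> 'a set \<Rightarrow> ('a \<Rightarrow> 'b) \<Rightarrow> nat"
where
  "score G G' U \<phi> =
     card {(v1, v2) \<in> U \<times> U. (v1, v2) \<in> parcs G \<and> (\<phi> v1, \<phi> v2) \<in> parcs G'}"

definition DMCES ::
  "'a pair_pre_digraph \<Rightarrow> ('a \<Rightarrow> 'l) \<Rightarrow> 'b pair_pre_digraph \<Rightarrow> ('b \<Rightarrow> 'l) \<Rightarrow> nat"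
where
  "DMCES G lab G' lab' = Max {score G G' U \<phi> | U \<phi>. feasible G lab G' lab' U \<phi>}"


section \<open>Cliques\<close>

text \<open>
  Undirected graphs are symmetric loop-free digraphs (\<^const>\<open>pair_graph\<close>).
\<close>

definition clique :: "'a pair_pre_digraph \<Rightarrow> 'a set \<Rightarrow> bool" where
  "clique H K \<longleftrightarrow> K \<subseteq> pverts H \<and> (\<forall>u\<in>K. \<forall>v\<in>K. u \<noteq> v \<longrightarrow> (u, v) \<in> parcs H)"

definition max_clique_size :: "'a pair_pre_digraph \<Rightarrow> nat" where
  "max_clique_size H = Max {card K | K. clique H K}"


section \<open>A random access machine\<close>

text \<open>
  Programs are structured programs for a random access machine with registers addressed by
  constants, a memory addressed through registers, and a write-only output tape. Every elementary
  instruction and every test costs one step. The only arithmetic is addition and truncated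
  subtraction: in \<open>t\<close> steps the bit length of a stored number grows by at most \<open>O(t)\<close>, so the
  unit-cost measure does not hide superpolynomial work (as it would with unit-cost multiplication).
\<close>

type_synonym reg = nat

datatype com =
    Skip
  | Const reg nat
  | Copy reg reg
  | Add reg reg reg
  | Sub reg reg reg
  | Load reg reg
  | Store reg reg
  | Write reg
  | Seq com com
  | IfNZ reg com com
  | WhileNZ reg com

record ram =
  regs :: "reg \<Rightarrow> nat"
  mem :: "nat \<Rightarrow> nat"
  outp :: "nat list"

definition set_reg :: "reg \<Rightarrow> nat \<Rightarrow> ram \<Rightarrow> ram" where
  "set_reg r x s = s\<lparr>regs := (regs s)(r := x)\<rparr>"

text \<open>
  \<open>exec c s t s'\<close>: started in \<open>s\<close>, the program \<open>c\<close> halts in \<open>s'\<close> after exactly \<open>t\<close> steps.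
\<close>

inductive exec :: "com \<Rightarrow> ram \<Rightarrow> nat \<Rightarrow> ram \<Rightarrow> bool" where
  Skip: "exec Skip s 1 s"
| Const: "exec (Const r k) s 1 (set_reg r k s)"
| Copy: "exec (Copy r a) s 1 (set_reg r (regs s a) s)"
| Add: "exec (Add r a b) s 1 (set_reg r (regs s a + regs s b) s)"
| Sub: "exec (Sub r a b) s 1 (set_reg r (regs s a - regs s b) s)"
| Load: "exec (Load r a) s 1 (set_reg r (mem s (regs s a)) s)"
| Store: "exec (Store a b) s 1 (s\<lparr>mem := (mem s)(regs s a := regs s b)\<rparr>)"
| Write: "exec (Write a) s 1 (s\<lparr>outp := outp s @ [regs s a]\<rparr>)"
| Seq: "exec c1 s t1 s' \<Longrightarrow> exec c2 s' t2 s'' \<Longrightarrow> exec (Seq c1 c2) s (t1 + t2) s''"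
| IfTrue: "regs s r \<noteq> 0 \<Longrightarrow> exec c1 s t s' \<Longrightarrow> exec (IfNZ r c1 c2) s (1 + t) s'"
| IfFalse: "regs s r = 0 \<Longrightarrow> exec c2 s t s' \<Longrightarrow> exec (IfNZ r c1 c2) s (1 + t) s'"
| WhileFalse: "regs s r = 0 \<Longrightarrow> exec (WhileNZ r c) s 1 s"
| WhileTrue: "regs s r \<noteq> 0 \<Longrightarrow> exec c s t1 s' \<Longrightarrow> exec (WhileNZ r c) s' t2 s'' \<Longrightarrow>
    exec (WhileNZ r c) s (1 + t1 + t2) s''"

text \<open>
  The input occupies the memory cells from address 0 on; all other cells and registers are 0.
\<close>

definition start :: "nat list \<Rightarrow> ram" where
  "start xs = \<lparr>regs = (\<lambda>_. 0), mem = (\<lambda>i. if i < length xs then xs ! i else 0), outp = []\<rparr>"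

definition outputs :: "com \<Rightarrow> nat list \<Rightarrow> nat \<Rightarrow> nat list \<Rightarrow> bool" where
  "outputs c xs t ys \<longleftrightarrow> (\<exists>s'. exec c (start xs) t s' \<and> outp s' = ys)"


section \<open>Encoding of graphs\<close>

text \<open>Row-major adjacency matrix with respect to an enumeration \<open>vs\<close> of the nodes.\<close>

definition adj_matrix :: "'a pair_pre_digraph \<Rightarrow> 'a list \<Rightarrow> nat list" where
  "adj_matrix G vs = [if (u, v) \<in> parcs G then 1 else 0. u \<leftarrow> vs, v \<leftarrow> vs]"

definition enumerates :: "'a list \<Rightarrow> 'a pair_pre_digraph \<Rightarrow> bool" where
  "enumerates vs G \<longleftrightarrow> distinct vs \<and> set vs = pverts G"

text \<open>
  Labels are atomic: \<open>code\<close> names each label by one number, stored in one cell.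
\<close>

definition encode_labeled ::
  "('l \<Rightarrow> nat) \<Rightarrow> 'a pair_pre_digraph \<Rightarrow> ('a \<Rightarrow> 'l) \<Rightarrow> 'a list \<Rightarrow> nat list"
where
  "encode_labeled code G lab vs = length vs # map (\<lambda>v. code (lab v)) vs @ adj_matrix G vs"

text \<open>
  Since the whole matrix has to be written to the output tape, a program running in polynomial
  time can only output graphs of polynomial size.
\<close>

definition encode_unlabeled :: "'a pair_pre_digraph \<Rightarrow> 'a list \<Rightarrow> nat list" where
  "encode_unlabeled H vs = length vs # adj_matrix H vs"

end

theory Submission
  imports Defs
begin

text \<open>
  The nodes of the constructed graph are the pairs \<open>((u, v), (u', v'))\<close> of an arc of \<open>G\<close> and an arc
  of \<open>G'\<close> with matching labels; two of them are adjacent if sending the first endpoints to the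
  second ones is a well-defined injective map and the arcs of \<open>G\<close> differ. Such maps glue along a
  clique, so a clique is the same as a partial injection together with some of the arcs it
  preserves. A pass over all quadruples of nodes counts the label-matching arc pairs, and a pass
  over all pairs of quadruples writes the adjacency matrix restricted to them, so the program is a
  fixed nest of loops, each running at most \<open>|V| + |V'|\<close> times.
\<close>

section \<open>Compiling counting loops to the random access machine\<close>

text \<open>\<open>exec\<close> counts steps exactly. Here \<open>T\<close> is only an upper bound,
  so that the branches of a conditional and all rounds of a loop can share one.\<close>

definition runs :: "com \<Rightarrow> nat \<Rightarrow> ram \<Rightarrow> (ram \<Rightarrow> bool) \<Rightarrow> bool" where
  "runs c T s Q \<longleftrightarrow> (\<exists>t s'. exec c s t s' \<and> t \<le> T \<and> Q s')"

lemma runs_Skip: "Q s \<Longrightarrow> 1 \<le> T \<Longrightarrow> runs Skip T s Q"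
  unfolding runs_def by (blast intro: exec.Skip)

lemma runs_Const: "Q (set_reg r k s) \<Longrightarrow> 1 \<le> T \<Longrightarrow> runs (Const r k) T s Q"
  unfolding runs_def by (blast intro: exec.Const)

lemma runs_Copy: "Q (set_reg r (regs s a) s) \<Longrightarrow> 1 \<le> T \<Longrightarrow> runs (Copy r a) T s Q"
  unfolding runs_def by (blast intro: exec.Copy)

lemma runs_Add: "Q (set_reg r (regs s a + regs s b) s) \<Longrightarrow> 1 \<le> T \<Longrightarrow> runs (Add r a b) T s Q"
  unfolding runs_def by (blast intro: exec.Add)

lemma runs_Sub: "Q (set_reg r (regs s a - regs s b) s) \<Longrightarrow> 1 \<le> T \<Longrightarrow> runs (Sub r a b) T s Q"
  unfolding runs_def by (blast intro: exec.Sub)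

lemma runs_Load: "Q (set_reg r (mem s (regs s a)) s) \<Longrightarrow> 1 \<le> T \<Longrightarrow> runs (Load r a) T s Q"
  unfolding runs_def by (blast intro: exec.Load)

lemma runs_Write: "Q (s\<lparr>outp := outp s @ [regs s a]\<rparr>) \<Longrightarrow> 1 \<le> T \<Longrightarrow> runs (Write a) T s Q"
  unfolding runs_def by (blast intro: exec.Write)

lemma runs_Seq:
  assumes "runs c1 T1 s P" and "\<And>s'. P s' \<Longrightarrow> runs c2 T2 s' Q"
  shows "runs (Seq c1 c2) (T1 + T2) s Q"
  using assms unfolding runs_def by (meson add_mono exec.Seq)

lemma runs_IfNZ:
  assumes "regs s r \<noteq> 0 \<Longrightarrow> runs c1 T s Q" and "regs s r = 0 \<Longrightarrow> runs c2 T s Q"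
  shows "runs (IfNZ r c1 c2) (1 + T) s Q"
  using assms unfolding runs_def by (metis add_left_mono exec.IfTrue exec.IfFalse)

lemma runs_mono: "runs c T s P \<Longrightarrow> T \<le> T' \<Longrightarrow> (\<And>s'. P s' \<Longrightarrow> Q s') \<Longrightarrow> runs c T' s Q"
  unfolding runs_def by (meson order_trans)

text \<open>The invariant is indexed by the value of the counter register, which each round lowers
  by one, so there are exactly \<open>n\<close> rounds. A round costs one test plus at most
  \<open>T\<close> steps; the leading 1 is the final failing test.\<close>

lemma runs_WhileNZ:
  assumes counter: "\<And>i s. I i s \<Longrightarrow> regs s r = i"
    and step: "\<And>i s. i < n \<Longrightarrow> I (Suc i) s \<Longrightarrow> runs c T s (I i)"
    and "I n s"
  shows "runs (WhileNZ r c) (1 + n * (1 + T)) s (I 0)"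
  using step \<open>I n s\<close>
proof (induction n arbitrary: s)
  case 0
  then show ?case
    unfolding runs_def using counter[of 0 s] exec.WhileFalse[of s r c] by auto
next
  case (Suc n)
  obtain t s' where body: "exec c s t s'" "t \<le> T" "I n s'"
    using Suc.prems unfolding runs_def by blast
  obtain t' s'' where rest: "exec (WhileNZ r c) s' t' s''" "t' \<le> 1 + n * (1 + T)" "I 0 s''"
    using Suc.IH[of s'] Suc.prems(1) body(3) unfolding runs_def by (meson less_SucI)
  have "regs s r \<noteq> 0"
    using counter[OF Suc.prems(2)] by simp
  then have "exec (WhileNZ r c) s (1 + t + t') s''"
    using body(1) rest(1) by (rule exec.WhileTrue)
  moreover have "1 + t + t' \<le> 1 + Suc n * (1 + T)"
    using body(2) rest(2) by simp
  ultimately show ?case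
    unfolding runs_def using rest(3) by blast
qed

section \<open>A source language of expressions and counting loops\<close>

text \<open>
  Variables are de Bruijn levels into an environment list. \<open>Total r e\<close> sums \<open>e\<close> while a fresh
  variable counts down from the value of variable \<open>r\<close> (exclusive) to \<open>0\<close>; \<open>Rep\<close> loops likewise.
\<close>

datatype aexp =
    Var nat
  | Num nat
  | Plus aexp aexp
  | Minus aexp aexp
  | Fetch aexp
  | Total nat aexp

datatype stm =
    Out aexp
  | When aexp stm
  | Then stm stm
  | Rep nat stm

primrec aval :: "(nat \<Rightarrow> nat) \<Rightarrow> aexp \<Rightarrow> nat list \<Rightarrow> nat" where
  "aval M (Var r) xs = xs ! r"
| "aval M (Num c) xs = c"
| "aval M (Plus a b) xs = aval M a xs + aval M b xs"
| "aval M (Minus a b) xs = aval M a xs - aval M b xs"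
| "aval M (Fetch a) xs = M (aval M a xs)"
| "aval M (Total r a) xs = sum_list (map (\<lambda>i. aval M a (xs @ [i])) (rev [0..<xs ! r]))"

primrec sout :: "(nat \<Rightarrow> nat) \<Rightarrow> stm \<Rightarrow> nat list \<Rightarrow> nat list" where
  "sout M (Out a) xs = [aval M a xs]"
| "sout M (When a p) xs = (if aval M a xs \<noteq> 0 then sout M p xs else [])"
| "sout M (Then p q) xs = sout M p xs @ sout M q xs"
| "sout M (Rep r p) xs = concat (map (\<lambda>i. sout M p (xs @ [i])) (rev [0..<xs ! r]))"

primrec aexp_scoped :: "nat \<Rightarrow> aexp \<Rightarrow> bool" where
  "aexp_scoped k (Var r) \<longleftrightarrow> r < k"
| "aexp_scoped k (Num c) \<longleftrightarrow> True"
| "aexp_scoped k (Plus a b) \<longleftrightarrow> aexp_scoped k a \<and> aexp_scoped k b"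
| "aexp_scoped k (Minus a b) \<longleftrightarrow> aexp_scoped k a \<and> aexp_scoped k b"
| "aexp_scoped k (Fetch a) \<longleftrightarrow> aexp_scoped k a"
| "aexp_scoped k (Total r a) \<longleftrightarrow> r < k \<and> aexp_scoped (Suc k) a"

primrec stm_scoped :: "nat \<Rightarrow> stm \<Rightarrow> bool" where
  "stm_scoped k (Out a) \<longleftrightarrow> aexp_scoped k a"
| "stm_scoped k (When a p) \<longleftrightarrow> aexp_scoped k a \<and> stm_scoped k p"
| "stm_scoped k (Then p q) \<longleftrightarrow> stm_scoped k p \<and> stm_scoped k q"
| "stm_scoped k (Rep r p) \<longleftrightarrow> r < k \<and> stm_scoped (Suc k) p"

section \<open>Compilation and time bounds\<close>

text \<open>
  Variables live in the even registers and temporaries in the odd ones, so that both stacks can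
  grow independently.
\<close>

definition var :: "nat \<Rightarrow> reg" where "var i = 2 * i"
definition tmp :: "nat \<Rightarrow> reg" where "tmp i = 2 * i + 1"

lemma var_tmp_simps [simp]:
  "var i = var j \<longleftrightarrow> i = j" "tmp i = tmp j \<longleftrightarrow> i = j" "var i \<noteq> tmp j" "tmp i \<noteq> var j"
  unfolding var_def tmp_def by presburger+

text \<open>\<open>k\<close> and \<open>j\<close> count the live variables and temporaries; the
  value is left in \<open>tmp j\<close>. In \<open>Total\<close> the counter is decremented before
  the summand is evaluated, so the values seen run from the bound minus one down to 0. The register
  \<open>tmp (Suc j)\<close> holds first the constant 1, then the summand.\<close>

primrec aexp_com :: "aexp \<Rightarrow> nat \<Rightarrow> nat \<Rightarrow> com" where
  "aexp_com (Var r) k j = Copy (tmp j) (var r)"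
| "aexp_com (Num c) k j = Const (tmp j) c"
| "aexp_com (Plus a b) k j =
     Seq (aexp_com a k j) (Seq (aexp_com b k (Suc j)) (Add (tmp j) (tmp j) (tmp (Suc j))))"
| "aexp_com (Minus a b) k j =
     Seq (aexp_com a k j) (Seq (aexp_com b k (Suc j)) (Sub (tmp j) (tmp j) (tmp (Suc j))))"
| "aexp_com (Fetch a) k j = Seq (aexp_com a k j) (Load (tmp j) (tmp j))"
| "aexp_com (Total r a) k j =
     Seq (Const (tmp j) 0) (Seq (Copy (var k) (var r))
       (WhileNZ (var k)
         (Seq (Const (tmp (Suc j)) 1) (Seq (Sub (var k) (var k) (tmp (Suc j)))
           (Seq (aexp_com a (Suc k) (Suc j)) (Add (tmp j) (tmp j) (tmp (Suc j))))))))"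

text \<open>No temporary has to survive the execution of a statement, so every evaluation starts at
  \<open>tmp 0\<close>.\<close>

primrec stm_com :: "stm \<Rightarrow> nat \<Rightarrow> com" where
  "stm_com (Out a) k = Seq (aexp_com a k 0) (Write (tmp 0))"
| "stm_com (When a p) k = Seq (aexp_com a k 0) (IfNZ (tmp 0) (stm_com p k) Skip)"
| "stm_com (Then p q) k = Seq (stm_com p k) (stm_com q k)"
| "stm_com (Rep r p) k =
     Seq (Copy (var k) (var r))
       (WhileNZ (var k)
         (Seq (Const (tmp 0) 1) (Seq (Sub (var k) (var k) (tmp 0)) (stm_com p (Suc k)))))"

text \<open>The argument of the polynomials is a common bound on all values in the environment.\<close>

primrec aexp_time :: "aexp \<Rightarrow> nat poly" where
  "aexp_time (Var r) = 1"
| "aexp_time (Num c) = 1"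
| "aexp_time (Plus a b) = aexp_time a + (aexp_time b + 1)"
| "aexp_time (Minus a b) = aexp_time a + (aexp_time b + 1)"
| "aexp_time (Fetch a) = aexp_time a + 1"
| "aexp_time (Total r a) = 1 + (1 + (1 + [:0, 1:] * (1 + (1 + (1 + (aexp_time a + 1))))))"

primrec stm_time :: "stm \<Rightarrow> nat poly" where
  "stm_time (Out a) = aexp_time a + 1"
| "stm_time (When a p) = aexp_time a + (1 + (1 + stm_time p))"
| "stm_time (Then p q) = stm_time p + stm_time q"
| "stm_time (Rep r p) = 1 + (1 + [:0, 1:] * (1 + (1 + (1 + stm_time p))))"

section \<open>Correctness and running time of the compiled code\<close>

text \<open>Registers beyond the two stacks are unconstrained, so popping just forgets the top
  entries. Compiled code never uses \<open>Store\<close>, hence the fixed memory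
  \<open>M\<close>.\<close>

definition holds :: "(nat \<Rightarrow> nat) \<Rightarrow> nat list \<Rightarrow> nat list \<Rightarrow> nat list \<Rightarrow> ram \<Rightarrow> bool" where
  "holds M xs ts out s \<longleftrightarrow> mem s = M \<and> outp s = out \<and>
     (\<forall>i<length xs. regs s (var i) = xs ! i) \<and> (\<forall>i<length ts. regs s (tmp i) = ts ! i)"

lemma holds_set_tmp:
  "holds M xs ts out s \<Longrightarrow> j = length ts \<Longrightarrow> v = w \<Longrightarrow>
    holds M xs (ts @ [v]) out (set_reg (tmp j) w s)"
  unfolding holds_def set_reg_def by (auto simp: nth_append less_Suc_eq)

text \<open>The typical use is after an operation: its operands \<open>us\<close> are popped and the
  result takes the lowest freed register.\<close>

lemma holds_reset_tmp:
  "holds M xs (ts @ us) out s \<Longrightarrow> j = length ts \<Longrightarrow> v = w \<Longrightarrow>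
    holds M xs (ts @ [v]) out (set_reg (tmp j) w s)"
  by (rule holds_set_tmp) (auto simp: holds_def nth_append)

lemma holds_set_var:
  "holds M xs ts out s \<Longrightarrow> k = length xs \<Longrightarrow> v = w \<Longrightarrow>
    holds M (xs @ [v]) ts out (set_reg (var k) w s)"
  unfolding holds_def set_reg_def by (auto simp: nth_append less_Suc_eq)

lemma holds_reset_var:
  "holds M (xs @ us) ts out s \<Longrightarrow> k = length xs \<Longrightarrow> v = w \<Longrightarrow>
    holds M (xs @ [v]) ts out (set_reg (var k) w s)"
  by (rule holds_set_var) (auto simp: holds_def nth_append)

lemma holds_appendD:
  "holds M (xs @ us) (ts @ vs) out s \<Longrightarrow> holds M xs ts out s"
  unfolding holds_def by (auto simp: nth_append)

lemma holds_varD: "holds M xs ts out s \<Longrightarrow> i < length xs \<Longrightarrow> regs s (var i) = xs ! i"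
  and holds_tmpD: "holds M xs ts out s \<Longrightarrow> i < length ts \<Longrightarrow> regs s (tmp i) = ts ! i"
  and holds_memD: "holds M xs ts out s \<Longrightarrow> mem s = M"
  unfolding holds_def by auto

text \<open>Loop bounds are variables, never computed or fetched values, and a counter inside a loop
  stays below its bound. So \<open>N\<close> keeps bounding the environment through all nested
  loops, and with it every number of rounds.\<close>

lemma runs_aexp_com:
  assumes "aexp_scoped k a" "k = length xs" "j = length ts" "\<forall>x\<in>set xs. x \<le> N" "holds M xs ts out s"
  shows "runs (aexp_com a k j) (poly (aexp_time a) N) s (holds M xs (ts @ [aval M a xs]) out)"
  using assms
proof (induction a arbitrary: k j xs ts s)
  case (Var r)
  then show ?case
    by (auto intro!: runs_Copy holds_set_tmp simp: holds_varD)
next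
  case (Num c)
  then show ?case
    by (auto intro!: runs_Const holds_set_tmp)
next
  case (Plus a b)
  note 1 = Plus.IH(1)[of k xs j ts s] and 2 = Plus.IH(2)[of k xs "Suc j" "ts @ [aval M a xs]"]
  show ?case
    unfolding aexp_com.simps aexp_time.simps poly_add using Plus.prems
    by (intro runs_Seq[OF 1] runs_Seq[OF 2] runs_Add
        holds_reset_tmp[where us = "[aval M a xs, aval M b xs]"])
      (auto simp: holds_tmpD nth_append)
next
  case (Minus a b)
  note 1 = Minus.IH(1)[of k xs j ts s] and 2 = Minus.IH(2)[of k xs "Suc j" "ts @ [aval M a xs]"]
  show ?case
    unfolding aexp_com.simps aexp_time.simps poly_add using Minus.prems
    by (intro runs_Seq[OF 1] runs_Seq[OF 2] runs_Sub
        holds_reset_tmp[where us = "[aval M a xs, aval M b xs]"])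
      (auto simp: holds_tmpD nth_append)
next
  case (Fetch a)
  note 1 = Fetch.IH[of k xs j ts s]
  show ?case
    unfolding aexp_com.simps aexp_time.simps poly_add using Fetch.prems
    by (intro runs_Seq[OF 1] runs_Load holds_reset_tmp[where us = "[aval M a xs]"])
      (auto simp: holds_tmpD holds_memD nth_append)
next
  case (Total r a)
  define n where "n = xs ! r"
  \<comment> \<open>The partial sum once the counter has come down to \<open>i\<close>: empty at
    \<open>i = n\<close>, complete at \<open>i = 0\<close>.\<close>
  define acc where "acc i = sum_list (map (\<lambda>i. aval M a (xs @ [i])) (rev [i..<n]))" for i
  define T where "T = poly (aexp_time a) N"
  have r: "r < k" and k: "k = length xs" and j: "j = length ts"
    and le: "\<forall>x\<in>set xs. x \<le> N" and scoped: "aexp_scoped (Suc k) a"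
    using Total.prems by auto
  have n: "n \<le> N"
    using r k le unfolding n_def by auto
  have acc_n: "acc n = 0" and acc_Suc: "i < n \<Longrightarrow> acc i = acc (Suc i) + aval M a (xs @ [i])" for i
    unfolding acc_def by (auto simp: upt_conv_Cons)
  let ?body = "Seq (Const (tmp (Suc j)) 1) (Seq (Sub (var k) (var k) (tmp (Suc j)))
           (Seq (aexp_com a (Suc k) (Suc j)) (Add (tmp j) (tmp j) (tmp (Suc j)))))"
  define I where "I i = holds M (xs @ [i]) (ts @ [acc i]) out" for i
  have loop: "runs (WhileNZ (var k) ?body) (1 + n * (1 + (1 + (1 + (T + 1))))) s' (I 0)"
    if "I n s'" for s'
  proof (rule runs_WhileNZ)
    show "regs s (var k) = i" if "I i s" for i s
      using holds_varD[OF that[unfolded I_def], of k] k by simp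
    show "runs ?body (1 + (1 + (T + 1))) s (I i)" if "i < n" "I (Suc i) s" for i s
    proof -
      let ?ts = "ts @ [acc (Suc i)]"
      have s: "holds M (xs @ [Suc i]) ?ts out s"
        using that unfolding I_def by simp
      \<comment> \<open>The constant 1 is popped first, because the summand is evaluated into the
        same register.\<close>
      have "runs (aexp_com a (Suc k) (Suc j)) T s'
              (holds M (xs @ [i]) (?ts @ [aval M a (xs @ [i])]) out)"
        if "holds M (xs @ [i]) (?ts @ [1]) out s'" for s'
        unfolding T_def using k j le \<open>i < n\<close> n holds_appendD[of _ _ "[]" _ "[1]"] that
        by (intro Total.IH scoped) auto
      then show ?thesis
      proof (intro runs_Seq)
        show "runs (Const (tmp (Suc j)) 1) 1 s (holds M (xs @ [Suc i]) (?ts @ [1]) out)"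
          using s j by (intro runs_Const holds_set_tmp) auto
        show "runs (Sub (var k) (var k) (tmp (Suc j))) 1 s' (holds M (xs @ [i]) (?ts @ [1]) out)"
          if "holds M (xs @ [Suc i]) (?ts @ [1]) out s'" for s'
          using that k j holds_varD[OF that, of k] holds_tmpD[OF that, of "Suc j"]
          by (intro runs_Sub holds_reset_var[where us = "[Suc i]"]) (auto simp: nth_append)
        show "runs (Add (tmp j) (tmp j) (tmp (Suc j))) 1 s' (I i)"
          if "holds M (xs @ [i]) (?ts @ [aval M a (xs @ [i])]) out s'" for s'
          using that k j holds_tmpD[OF that, of "Suc j"] holds_tmpD[OF that, of j] \<open>i < n\<close>
          unfolding I_def
          by (intro runs_Add holds_reset_tmp[where us = "[acc (Suc i), aval M a (xs @ [i])]"])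
            (auto simp: nth_append acc_Suc)
      qed
    qed
  qed (use that in simp)
  have "runs (aexp_com (Total r a) k j) (1 + (1 + (1 + n * (1 + (1 + (1 + (T + 1)))))))
          s (I 0)"
    unfolding aexp_com.simps
  proof (intro runs_Seq loop)
    show "runs (Const (tmp j) 0) 1 s (holds M xs (ts @ [acc n]) out)"
      using Total.prems acc_n by (intro runs_Const holds_set_tmp) auto
    show "runs (Copy (var k) (var r)) 1 s' (I n)" if "holds M xs (ts @ [acc n]) out s'" for s'
      using that k r unfolding I_def
      by (intro runs_Copy holds_set_var) (auto simp: n_def holds_varD)
  qed
  then show ?case
  proof (rule runs_mono)
    show "1 + (1 + (1 + n * (1 + (1 + (1 + (T + 1)))))) \<le> poly (aexp_time (Total r a)) N"
      using n by (auto simp: T_def intro!: add_mono)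
    show "holds M xs (ts @ [aval M (Total r a) xs]) out s'" if "I 0 s'" for s'
      using holds_appendD[of M xs "[0]" "ts @ [acc 0]" "[]"] that
      unfolding I_def acc_def n_def by simp
  qed
qed

text \<open>The induction parallels the one for expressions, with the output tape in place of the
  accumulator.\<close>

lemma runs_stm_com:
  assumes "stm_scoped k p" "k = length xs" "\<forall>x\<in>set xs. x \<le> N" "holds M xs [] out s"
  shows "runs (stm_com p k) (poly (stm_time p) N) s (holds M xs [] (out @ sout M p xs))"
  using assms
proof (induction p arbitrary: k xs out s)
  case (Out a)
  have "runs (aexp_com a k 0) (poly (aexp_time a) N) s (holds M xs [aval M a xs] out)"
    using runs_aexp_com[of k a xs 0 "[]" N M out s] Out by simp
  then show ?case
    unfolding stm_com.simps stm_time.simps poly_add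
    by (elim runs_Seq) (auto intro!: runs_Write simp: holds_def)
next
  case (When a p)
  have "runs (aexp_com a k 0) (poly (aexp_time a) N) s (holds M xs [aval M a xs] out)"
    using runs_aexp_com[of k a xs 0 "[]" N M out s] When.prems by simp
  then show ?case
    unfolding stm_com.simps stm_time.simps poly_add poly_1
  proof (rule runs_Seq)
    fix s' assume s': "holds M xs [aval M a xs] out s'"
    then have "holds M xs [] out s'"
      using holds_appendD[of M xs "[]" "[]"] by simp
    moreover have "regs s' (tmp 0) = aval M a xs"
      using holds_tmpD[OF s', of 0] by simp
    moreover have "runs (stm_com p k) (poly (stm_time p) N) s'
        (holds M xs [] (out @ sout M p xs))"
      using When.IH When.prems calculation(1) by simp
    \<comment> \<open>The second 1 in the bound covers the single step of the \<open>Skip\<close>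
      branch.\<close>
    ultimately show "runs (IfNZ (tmp 0) (stm_com p k) Skip) (1 + (1 + poly (stm_time p) N)) s'
        (holds M xs [] (out @ sout M (When a p) xs))"
      by (intro runs_IfNZ) (auto intro!: runs_Skip elim: runs_mono)
  qed
next
  case (Then p q)
  then show ?case
    by (auto intro!: runs_Seq Then.IH simp flip: append_assoc)
next
  case (Rep r p)
  define n where "n = xs ! r"
  \<comment> \<open>The tape contents once the counter has come down to \<open>i\<close>.\<close>
  define sofar where "sofar i = out @ concat (map (\<lambda>i. sout M p (xs @ [i])) (rev [i..<n]))" for i
  define T where "T = poly (stm_time p) N"
  have r: "r < k" and k: "k = length xs"
    and le: "\<forall>x\<in>set xs. x \<le> N" and scoped: "stm_scoped (Suc k) p"
    using Rep.prems by auto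
  have n: "n \<le> N"
    using r k le unfolding n_def by auto
  have sofar_n: "sofar n = out"
    and sofar_Suc: "i < n \<Longrightarrow> sofar i = sofar (Suc i) @ sout M p (xs @ [i])" for i
    unfolding sofar_def by (auto simp: upt_conv_Cons)
  let ?body = "Seq (Const (tmp 0) 1) (Seq (Sub (var k) (var k) (tmp 0)) (stm_com p (Suc k)))"
  define I where "I i = holds M (xs @ [i]) [] (sofar i)" for i
  have loop: "runs (WhileNZ (var k) ?body) (1 + n * (1 + (1 + (1 + T)))) s' (I 0)"
    if "I n s'" for s'
  proof (rule runs_WhileNZ)
    show "regs s (var k) = i" if "I i s" for i s
      using holds_varD[OF that[unfolded I_def], of k] k by simp
    show "runs ?body (1 + (1 + T)) s (I i)" if "i < n" "I (Suc i) s" for i s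
    proof (intro runs_Seq)
      show "runs (Const (tmp 0) 1) 1 s (holds M (xs @ [Suc i]) ([] @ [1]) (sofar (Suc i)))"
        using that unfolding I_def by (intro runs_Const holds_set_tmp) auto
      show "runs (Sub (var k) (var k) (tmp 0)) 1 s' (holds M (xs @ [i]) ([] @ [1]) (sofar (Suc i)))"
        if "holds M (xs @ [Suc i]) ([] @ [1]) (sofar (Suc i)) s'" for s'
        using that k holds_varD[OF that, of k] holds_tmpD[OF that, of 0]
        by (intro runs_Sub holds_reset_var[where us = "[Suc i]"]) (auto simp: nth_append)
      show "runs (stm_com p (Suc k)) T s' (I i)"
        if "holds M (xs @ [i]) ([] @ [1]) (sofar (Suc i)) s'" for s'
        unfolding T_def I_def sofar_Suc[OF \<open>i < n\<close>]
        using k le \<open>i < n\<close> n holds_appendD[of _ "xs @ [i]" "[]" "[]"] that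
        by (intro Rep.IH scoped) auto
    qed
  qed (use that in simp)
  have "runs (stm_com (Rep r p) k) (1 + (1 + n * (1 + (1 + (1 + T))))) s (I 0)"
    unfolding stm_com.simps
  proof (intro runs_Seq loop)
    show "runs (Copy (var k) (var r)) 1 s (I n)"
      using Rep.prems unfolding I_def
      by (intro runs_Copy holds_set_var) (auto simp: n_def[symmetric] sofar_n holds_varD)
  qed
  then show ?case
  proof (rule runs_mono)
    show "1 + (1 + n * (1 + (1 + (1 + T)))) \<le> poly (stm_time (Rep r p)) N"
      using n by (auto simp: T_def intro!: add_mono)
    show "holds M xs [] (out @ sout M (Rep r p) xs) s'" if "I 0 s'" for s'
      using holds_appendD[of M xs "[0]" "[]" "[]"] that
      unfolding I_def sofar_def n_def by simp
  qed
qed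


section \<open>The graph of consistent arc pairs\<close>

definition arc_pairs ::
  "'a pair_pre_digraph \<Rightarrow> ('a \<Rightarrow> 'l) \<Rightarrow> 'b pair_pre_digraph \<Rightarrow> ('b \<Rightarrow> 'l) \<Rightarrow>
    (('a \<times> 'a) \<times> ('b \<times> 'b)) set"
where
  "arc_pairs G lab G' lab' = {((u, v), (u', v')).
     (u, v) \<in> parcs G \<and> (u', v') \<in> parcs G' \<and> lab u = lab' u' \<and> lab v = lab' v'}"

text \<open>Each equivalence says at once that equal nodes have equal images and distinct nodes
  distinct ones. Given the equivalences, the last conjunct excludes exactly two equal arguments,
  which makes the relation irreflexive.\<close>

fun consistent :: "('a \<times> 'a) \<times> ('b \<times> 'b) \<Rightarrow> ('a \<times> 'a) \<times> ('b \<times> 'b) \<Rightarrow> bool" where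
  "consistent ((u, v), (u', v')) ((x, y), (x', y')) \<longleftrightarrow>
     ((u = x) = (u' = x') \<and> (u = y) = (u' = y')) \<and> ((v = x) = (v' = x') \<and> (v = y) = (v' = y')) \<and>
     \<not> (u = x \<and> v = y)"

lemma consistent_sym: "consistent p q \<Longrightarrow> consistent q p"
  by (cases "(p, q)" rule: consistent.cases) auto

lemma consistent_irrefl: "\<not> consistent p p"
  by (cases "(p, p)" rule: consistent.cases) auto

text \<open>The endpoint matchings of all members of \<open>K\<close> glue to a partial injection.
  Distinct members have distinct arcs of \<open>G\<close>, all of them preserved, so
  \<open>K\<close> injects into the scored arcs. The map may preserve further arcs, hence only an
  inequality.\<close>

lemma feasible_of_consistent:
  assumes G: "pair_digraph G" and G': "pair_digraph G'"
    and K: "K \<subseteq> arc_pairs G lab G' lab'"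
    and cons: "\<And>p q. p \<in> K \<Longrightarrow> q \<in> K \<Longrightarrow> p \<noteq> q \<Longrightarrow> consistent p q"
  shows "\<exists>U \<phi>. feasible G lab G' lab' U \<phi> \<and> card K \<le> score G G' U \<phi>"
proof -
  interpret G: pair_digraph G by (rule G)
  interpret G': pair_digraph G' by (rule G')
  define R where "R = {(a, b). \<exists>u v u' v'. ((u, v), (u', v')) \<in> K \<and>
    ((a, b) = (u, u') \<or> (a, b) = (v, v'))}"
  \<comment> \<open>Left to right this says that \<open>R\<close> is single-valued, right to left
    that it is injective.\<close>
  have R_iff: "a = c \<longleftrightarrow> b = d" if ab: "(a, b) \<in> R" and cd: "(c, d) \<in> R" for a b c d
  proof -
    obtain u v u' v' where p: "((u, v), (u', v')) \<in> K" "(a, b) = (u, u') \<or> (a, b) = (v, v')"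
      using ab unfolding R_def by blast
    obtain x y x' y' where q: "((x, y), (x', y')) \<in> K" "(c, d) = (x, x') \<or> (c, d) = (y, y')"
      using cd unfolding R_def by blast
    show ?thesis
    proof (cases "((u, v), (u', v')) = ((x, y), (x', y'))")
      case True
      \<comment> \<open>Within a single arc pair the claim comes from loop-freeness, as
        \<open>consistent\<close> only compares different pairs.\<close>
      have "(u, v) \<in> parcs G" "(u', v') \<in> parcs G'"
        using p(1) K unfolding arc_pairs_def by auto
      then have "u \<noteq> v" "u' \<noteq> v'"
        using G.no_loops[of "(u, v)"] G'.no_loops[of "(u', v')"] by auto
      then show ?thesis using True p(2) q(2) by auto
    next
      case False
      then show ?thesis using cons[OF p(1) q(1) False] p(2) q(2) by auto
    qed
  qed
  define \<phi> where "\<phi> a = (SOME b. (a, b) \<in> R)" for a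
  have \<phi>: "\<phi> a = b" if "(a, b) \<in> R" for a b
    using that R_iff someI[of "\<lambda>b. (a, b) \<in> R" b] unfolding \<phi>_def by blast
  have R_verts: "a \<in> pverts G \<and> b \<in> pverts G' \<and> lab a = lab' b" if "(a, b) \<in> R" for a b
    using that K G.in_arcsD1 G.in_arcsD2 G'.in_arcsD1 G'.in_arcsD2
    unfolding R_def arc_pairs_def by auto
  let ?U = "fst ` R"
  let ?S = "{(v1, v2) \<in> ?U \<times> ?U. (v1, v2) \<in> parcs G \<and> (\<phi> v1, \<phi> v2) \<in> parcs G'}"
  have "feasible G lab G' lab' ?U \<phi>"
    unfolding feasible_def
  proof (intro conjI ballI subsetI inj_onI)
    show "a = b" if "a \<in> ?U" "b \<in> ?U" "\<phi> a = \<phi> b" for a b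
      using that R_iff \<phi> by auto
  qed (use R_verts \<phi> in auto)
  moreover have "card K \<le> score G G' ?U \<phi>"
    unfolding score_def
  proof (rule card_inj_on_le)
    show "inj_on fst K"
    proof (rule inj_onI, rule ccontr)
      fix p q assume "p \<in> K" "q \<in> K" "fst p = fst q" "p \<noteq> q"
      then show False
        using cons[of p q] by (cases "(p, q)" rule: consistent.cases) auto
    qed
    show "fst ` K \<subseteq> ?S"
    proof
      fix e assume "e \<in> fst ` K"
      then obtain u v u' v' where e: "e = (u, v)" and p: "((u, v), (u', v')) \<in> K"
        by force
      have "(u, u') \<in> R" "(v, v') \<in> R"
        using p unfolding R_def by auto
      then show "e \<in> ?S"
        using \<phi> p K e unfolding arc_pairs_def by force
    qed
    show "finite ?S"
      by (rule finite_subset[OF _ G.pair_finite_arcs]) auto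
  qed
  ultimately show ?thesis by blast
qed

text \<open>Pair each preserved arc with its image under \<open>\<phi>\<close>; injectivity on
  \<open>U\<close> yields the equivalences.\<close>

lemma consistent_of_feasible:
  assumes f: "feasible G lab G' lab' U \<phi>"
  shows "\<exists>K \<subseteq> arc_pairs G lab G' lab'.
    (\<forall>p\<in>K. \<forall>q\<in>K. p \<noteq> q \<longrightarrow> consistent p q) \<and> card K = score G G' U \<phi>"
proof -
  let ?S = "{(v1, v2) \<in> U \<times> U. (v1, v2) \<in> parcs G \<and> (\<phi> v1, \<phi> v2) \<in> parcs G'}"
  let ?f = "\<lambda>(u, v). ((u, v), (\<phi> u, \<phi> v))"
  have \<phi>: "\<phi> a = \<phi> b \<longleftrightarrow> a = b" if "a \<in> U" "b \<in> U" for a b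
    using f that unfolding feasible_def inj_on_def by blast
  have "?f ` ?S \<subseteq> arc_pairs G lab G' lab'"
    using f unfolding feasible_def arc_pairs_def by auto
  moreover have "\<forall>p\<in>?f ` ?S. \<forall>q\<in>?f ` ?S. p \<noteq> q \<longrightarrow> consistent p q"
    using \<phi> by auto
  moreover have "card (?f ` ?S) = score G G' U \<phi>"
    unfolding score_def by (rule card_image) (auto simp: inj_on_def)
  ultimately show ?thesis by blast
qed

section \<open>Graphs on list positions and their maximum cliques\<close>

text \<open>With positions as nodes, the adjacency matrix in natural order is the table of
  \<open>R\<close> along \<open>qs\<close>, which is what nested loops can print.\<close>

definition list_graph :: "('q \<Rightarrow> 'q \<Rightarrow> bool) \<Rightarrow> 'q list \<Rightarrow> nat pair_pre_digraph" where
  "list_graph R qs = \<lparr>pverts = {0..<length qs},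
     parcs = {(i, j). i < length qs \<and> j < length qs \<and> R (qs ! i) (qs ! j)}\<rparr>"

lemma pair_graph_list_graph:
  assumes "\<And>p q. R p q \<Longrightarrow> R q p" and "\<And>p. \<not> R p p"
  shows "pair_graph (list_graph R qs)"
proof
  show "finite (parcs (list_graph R qs))"
    by (rule finite_subset[of _ "{0..<length qs} \<times> {0..<length qs}"]) (auto simp: list_graph_def)
  show "symmetric (with_proj (list_graph R qs))"
    using assms(1) by (auto simp: list_graph_def symmetric_def arcs_ends_def arc_to_ends_def intro!: symI)
qed (auto simp: list_graph_def assms(2))

lemma encode_list_graph:
  "encode_unlabeled (list_graph R qs) [0..<length qs] =
    length qs # concat (map (\<lambda>p. map (\<lambda>q. of_bool (R p q)) qs) qs)"
proof -
  have row: "map (\<lambda>q. of_bool (R p q)) qs = map (\<lambda>j. of_bool (R p (qs ! j))) [0..<length qs]" for p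
    by (rule nth_equalityI) auto
  have "map (\<lambda>p. map (\<lambda>q. of_bool (R p q) :: nat) qs) qs =
      map (\<lambda>i. map (\<lambda>j. of_bool (R (qs ! i) (qs ! j))) [0..<length qs]) [0..<length qs]"
    unfolding row by (rule nth_equalityI) auto
  also have "concat \<dots> = adj_matrix (list_graph R qs) [0..<length qs]"
    unfolding adj_matrix_def
    by (rule arg_cong[of _ _ concat]) (auto simp: list_graph_def)
  finally show ?thesis
    by (simp add: encode_unlabeled_def)
qed

text \<open>In the application \<open>qs\<close> lists index quadruples and \<open>f\<close> decodes
  them. Cliques correspond to pairwise consistent sets of arc pairs of the same size, so
  \<open>feasible_of_consistent\<close> and \<open>consistent_of_feasible\<close> give the two
  inequalities.\<close>

lemma max_clique_size_list_graph:
  fixes f :: "'q \<Rightarrow> ('a \<times> 'a) \<times> ('b \<times> 'b)"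
  assumes G: "pair_digraph G" and G': "pair_digraph G'"
    and qs: "distinct qs" and f: "bij_betw f (set qs) (arc_pairs G lab G' lab')"
    and R: "\<And>p q. p \<in> set qs \<Longrightarrow> q \<in> set qs \<Longrightarrow> R p q \<longleftrightarrow> consistent (f p) (f q)"
  shows "max_clique_size (list_graph R qs) = DMCES G lab G' lab'"
proof -
  interpret G: pair_digraph G by (rule G)
  let ?H = "list_graph R qs"
  define g where "g i = f (qs ! i)" for i
  have "bij_betw ((!) qs) {0..<length qs} (set qs)"
    using bij_betw_nth[OF qs] by (simp add: atLeast0LessThan)
  then have g: "bij_betw g {0..<length qs} (arc_pairs G lab G' lab')"
    using bij_betw_trans[OF _ f] unfolding g_def comp_def by blast
  have arcs: "(i, j) \<in> parcs ?H \<longleftrightarrow> consistent (g i) (g j)"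
    if "i < length qs" "j < length qs" for i j
    using that R by (simp add: list_graph_def g_def)
  have clique_iff: "clique ?H K \<longleftrightarrow> K \<subseteq> {0..<length qs} \<and>
      (\<forall>p\<in>g ` K. \<forall>q\<in>g ` K. p \<noteq> q \<longrightarrow> consistent p q)" for K
  proof (cases "K \<subseteq> {0..<length qs}")
    case True
    then have "inj_on g K"
      using g by (meson bij_betw_def inj_on_subset)
    then show ?thesis
      using True arcs unfolding clique_def inj_on_def
      by (auto simp: list_graph_def subset_eq) blast
  qed (simp add: clique_def list_graph_def)
  \<comment> \<open>Both sets are finite and nonempty, so \<open>Max\<close> is attained; the empty
    clique and the empty partial map are the witnesses.\<close>
  let ?C = "{card K | K. clique ?H K}"
  let ?S = "{score G G' U \<phi> | U \<phi>. feasible G lab G' lab' U \<phi>}"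
  have "?C \<subseteq> {..length qs}"
  proof clarsimp
    fix K assume "clique ?H K"
    then have "K \<subseteq> {0..<length qs}"
      using clique_iff by blast
    then show "card K \<le> length qs"
      using card_mono[of "{0..<length qs}" K] by simp
  qed
  then have finC: "finite ?C"
    by (rule finite_subset) simp
  have neC: "?C \<noteq> {}"
    using clique_iff[of "{}"] by auto
  have "score G G' U \<phi> \<le> card (parcs G)" for U \<phi>
    unfolding score_def by (rule card_mono) auto
  then have "?S \<subseteq> {..card (parcs G)}"
    by auto
  then have finS: "finite ?S"
    by (rule finite_subset) simp
  have neS: "?S \<noteq> {}"
    by (auto simp: feasible_def intro!: exI[of _ "{}"])
  have C_le: "\<exists>y\<in>?S. x \<le> y" if "x \<in> ?C" for x
  proof -
    obtain K where x: "x = card K" and K: "clique ?H K"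
      using \<open>x \<in> ?C\<close> by blast
    have "g ` K \<subseteq> arc_pairs G lab G' lab'" "card (g ` K) = card K"
      using K g clique_iff[of K] unfolding bij_betw_def
      by (blast, blast intro: card_image inj_on_subset)
    moreover have "\<exists>U \<phi>. feasible G lab G' lab' U \<phi> \<and> card (g ` K) \<le> score G G' U \<phi>"
      using K clique_iff[of K] by (intro feasible_of_consistent[OF G G' calculation(1)]) blast
    ultimately show ?thesis
      using x by auto
  qed
  have S_le: "\<exists>x\<in>?C. y \<le> x" if "y \<in> ?S" for y
  proof -
    obtain L where L: "L \<subseteq> arc_pairs G lab G' lab'" "y = card L"
        "\<forall>p\<in>L. \<forall>q\<in>L. p \<noteq> q \<longrightarrow> consistent p q"
      using \<open>y \<in> ?S\<close> consistent_of_feasible[of G lab G' lab'] by force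
    obtain K where K: "K \<subseteq> {0..<length qs}" "g ` K = L"
      using L(1) g unfolding bij_betw_def by (metis subset_imageE)
    then have "card K = y"
      using g L(2) unfolding bij_betw_def by (metis card_image inj_on_subset)
    then show ?thesis
      using clique_iff[of K] K L(3) by auto
  qed
  show ?thesis
    unfolding max_clique_size_def DMCES_def
  proof (rule antisym)
    show "Max ?C \<le> Max ?S"
      using C_le[OF Max_in[OF finC neC]] Max_ge[OF finS] order_trans by blast
    show "Max ?S \<le> Max ?C"
      using S_le[OF Max_in[OF finS neS]] Max_ge[OF finC] order_trans by blast
  qed
qed

section \<open>The reduction program\<close>

text \<open>Subtraction is truncated, so \<open>Minus (Num 1) a\<close> is negation, with every
  nonzero value counting as true.\<close>

definition Conj :: "aexp \<Rightarrow> aexp \<Rightarrow> aexp" where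
  "Conj a b = Minus (Num 1) (Plus (Minus (Num 1) a) (Minus (Num 1) b))"

definition Equal :: "aexp \<Rightarrow> aexp \<Rightarrow> aexp" where
  "Equal a b = Minus (Num 1) (Plus (Minus a b) (Minus b a))"

lemma aval_Conj [simp]: "aval M (Conj a b) xs = of_bool (aval M a xs \<noteq> 0 \<and> aval M b xs \<noteq> 0)"
  by (auto simp: Conj_def)

lemma aval_Equal [simp]: "aval M (Equal a b) xs = of_bool (aval M a xs = aval M b xs)"
  by (auto simp: Equal_def)

lemma aexp_scoped_Conj_Equal [simp]:
  "aexp_scoped k (Conj a b) \<longleftrightarrow> aexp_scoped k a \<and> aexp_scoped k b"
  "aexp_scoped k (Equal a b) \<longleftrightarrow> aexp_scoped k a \<and> aexp_scoped k b"
  by (auto simp: Conj_def Equal_def)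

definition label_at :: "aexp \<Rightarrow> nat \<Rightarrow> aexp" where
  "label_at b u = Fetch (Plus b (Plus (Num 1) (Var u)))"

text \<open>\<open>Total r (Var u)\<close> adds variable \<open>u\<close> once per round, which
  multiplies it by variable \<open>r\<close>. The address skips the length cell and the labels, then
  indexes the matrix row by row.\<close>

definition arc_at :: "aexp \<Rightarrow> nat \<Rightarrow> nat \<Rightarrow> nat \<Rightarrow> aexp" where
  "arc_at b r u v = Fetch (Plus b (Plus (Num 1) (Plus (Var r) (Plus (Total r (Var u)) (Var v)))))"

text \<open>The length \<open>1 + (n + n * n)\<close> of the first encoding, where the second one
  starts.\<close>

definition second_base :: aexp where
  "second_base = Plus (Num 1) (Plus (Var 0) (Total 0 (Var 0)))"

definition valid_exp :: "nat \<Rightarrow> aexp" where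
  "valid_exp k =
     Conj (Conj (arc_at (Num 0) 0 k (k + 1)) (arc_at second_base 1 (k + 2) (k + 3)))
       (Conj (Equal (label_at (Num 0) k) (label_at second_base (k + 2)))
         (Equal (label_at (Num 0) (k + 1)) (label_at second_base (k + 3))))"

definition same_exp :: "nat \<Rightarrow> nat \<Rightarrow> nat \<Rightarrow> nat \<Rightarrow> aexp" where
  "same_exp a b c d = Equal (Equal (Var a) (Var b)) (Equal (Var c) (Var d))"

definition consistent_exp :: aexp where
  "consistent_exp =
     Conj (Conj (same_exp 2 6 4 8) (same_exp 2 7 4 9))
       (Conj (Conj (same_exp 3 6 5 8) (same_exp 3 7 5 9))
         (Minus (Num 1) (Conj (Equal (Var 2) (Var 6)) (Equal (Var 3) (Var 7)))))"

text \<open>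
  Variables 0 and 1 hold the numbers of nodes of the two graphs, variables 2 to 5 one arc pair and
  variables 6 to 9 another.
\<close>

definition reduction :: stm where
  "reduction =
     Then (Out (Total 0 (Total 0 (Total 1 (Total 1 (valid_exp 2))))))
       (Rep 0 (Rep 0 (Rep 1 (Rep 1 (When (valid_exp 2)
         (Rep 0 (Rep 0 (Rep 1 (Rep 1 (When (valid_exp 6) (Out consistent_exp)))))))))))"

lemma stm_scoped_reduction: "stm_scoped 2 reduction"
  by (simp add: reduction_def valid_exp_def consistent_exp_def same_exp_def arc_at_def label_at_def
      second_base_def)

section \<open>The output as a function of lists\<close>

lemma concat_map_product:
  "concat (map g (List.product xs ys)) = concat (map (\<lambda>x. concat (map (\<lambda>y. g (x, y)) ys)) xs)"
  by (induction xs) (auto simp: comp_def)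

lemma sum_list_map_product:
  fixes g :: "_ \<Rightarrow> nat"
  shows "sum_list (map g (List.product xs ys)) =
    sum_list (map (\<lambda>x. sum_list (map (\<lambda>y. g (x, y)) ys)) xs)"
  by (induction xs) (auto simp: comp_def)

lemma concat_map_if:
  "concat (map (\<lambda>x. if P x then g x else []) xs) = concat (map g (filter P xs))"
  by (induction xs) auto

lemma sum_list_of_bool: "sum_list (map (\<lambda>x. of_bool (P x)) xs) = length (filter P xs)"
  by (induction xs) auto

text \<open>Lists the quadruples in the order in which four nested downward-counting loops visit
  them.\<close>

definition quads :: "nat \<Rightarrow> nat \<Rightarrow> ((nat \<times> nat) \<times> (nat \<times> nat)) list" where
  "quads n m = List.product (List.product (rev [0..<n]) (rev [0..<n]))
     (List.product (rev [0..<m]) (rev [0..<m]))"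

fun valid :: "(nat \<Rightarrow> nat) \<Rightarrow> nat \<Rightarrow> nat \<Rightarrow> (nat \<times> nat) \<times> (nat \<times> nat) \<Rightarrow> bool" where
  "valid M n m ((u, v), (u', v')) \<longleftrightarrow> (let b = 1 + (n + n * n) in
     (M (1 + (n + (n * u + v))) \<noteq> 0 \<and> M (b + (1 + (m + (m * u' + v')))) \<noteq> 0) \<and>
     M (1 + u) = M (b + (1 + u')) \<and> M (1 + v) = M (b + (1 + v')))"

lemma aval_valid_exp:
  "aval M (valid_exp 2) [n, m, u, v, u', v'] = of_bool (valid M n m ((u, v), (u', v')))"
  "aval M (valid_exp 6) [n, m, x, y, x', y', u, v, u', v'] =
    of_bool (valid M n m ((u, v), (u', v')))"
  by (simp_all add: valid_exp_def arc_at_def label_at_def second_base_def sum_list_triv Let_def)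

lemma aval_consistent_exp:
  "aval M consistent_exp [n, m, u, v, u', v', x, y, x', y'] =
    of_bool (consistent ((u, v), (u', v')) ((x, y), (x', y')))"
  by (simp add: consistent_exp_def same_exp_def)

text \<open>Four nested loops amount to one loop over \<open>quads\<close>, and \<open>When\<close>
  acts as a filter. All passes thus enumerate the same \<open>qs\<close> in the same order, so
  count, rows and columns agree.\<close>

lemma sout_reduction:
  assumes "qs = filter (valid M n m) (quads n m)"
  shows "sout M reduction [n, m] =
    length qs # concat (map (\<lambda>p. map (\<lambda>q. of_bool (consistent p q)) qs) qs)"
proof -
  have "length qs = sum_list (map (\<lambda>q. of_bool (valid M n m q)) (quads n m))"
    unfolding assms sum_list_of_bool ..
  moreover have "map h qs =
      concat (map (\<lambda>q. if valid M n m q then [h q] else []) (quads n m))"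
    for h :: "_ \<Rightarrow> nat"
    unfolding concat_map_if assms by (induction "filter (valid M n m) (quads n m)") auto
  moreover have "concat (map h qs) =
      concat (map (\<lambda>q. if valid M n m q then h q else []) (quads n m))"
    for h :: "_ \<Rightarrow> nat list"
    unfolding concat_map_if assms ..
  ultimately show ?thesis
    unfolding quads_def concat_map_product sum_list_map_product
    by (simp add: reduction_def aval_valid_exp aval_consistent_exp del: valid.simps consistent.simps
        cong: if_cong)
qed

text \<open>The prologue loads the two node counts into variables 0 and 1. Since
  \<open>second_base\<close> mentions only variable 0, it can be evaluated before variable 1 is
  set.\<close>

definition reduction_prog :: com where
  "reduction_prog =
     Seq (aexp_com (Fetch (Num 0)) 0 0) (Seq (Copy (var 0) (tmp 0))
       (Seq (aexp_com (Fetch second_base) 1 0) (Seq (Copy (var 1) (tmp 0))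
         (stm_com reduction 2))))"

definition reduction_time :: "nat poly" where
  "reduction_time = aexp_time (Fetch (Num 0)) + (1 +
     (aexp_time (Fetch second_base) + (1 + stm_time reduction)))"

lemma runs_reduction_prog:
  assumes s: "holds M [] [] [] s" and n: "M 0 = n" "n \<le> N" and m: "M (1 + (n + n * n)) = m" "m \<le> N"
  shows "runs reduction_prog (poly reduction_time N) s
    (\<lambda>s'. outp s' = sout M reduction [n, m])"
  unfolding reduction_prog_def reduction_time_def poly_add poly_1
proof (intro runs_Seq)
  show "runs (aexp_com (Fetch (Num 0)) 0 0) (poly (aexp_time (Fetch (Num 0))) N) s
      (holds M [] [n] [])"
    using runs_aexp_com[of 0 "Fetch (Num 0)" "[]" 0 "[]" N M "[]" s] s n by simp
  show "runs (Copy (var 0) (tmp 0)) 1 s' (holds M [n] [] [])" if "holds M [] [n] [] s'" for s'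
    using that by (intro runs_Copy) (auto simp: holds_def set_reg_def)
  have "aval M (Fetch second_base) [n] = m"
    using m by (simp add: second_base_def sum_list_triv)
  then show "runs (aexp_com (Fetch second_base) 1 0) (poly (aexp_time (Fetch second_base)) N) s'
      (holds M [n] [m] [])" if "holds M [n] [] [] s'" for s'
    using runs_aexp_com[of 1 "Fetch second_base" "[n]" 0 "[]" N M "[]" s'] that n
    by (simp add: second_base_def)
  show "runs (Copy (var 1) (tmp 0)) 1 s' (holds M [n, m] [] [])" if "holds M [n] [m] [] s'" for s'
    using that by (intro runs_Copy) (auto simp: holds_def set_reg_def less_Suc_eq)
  show "runs (stm_com reduction 2) (poly (stm_time reduction) N) s'
      (\<lambda>s'. outp s' = sout M reduction [n, m])" if "holds M [n, m] [] [] s'" for s'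
    using runs_stm_com[OF stm_scoped_reduction, of "[n, m]" N M "[]" s'] that n m
    by (auto elim!: runs_mono simp: holds_def)
qed

section \<open>Decoding the input\<close>

lemma nth_concat_map_map:
  assumes "i < length us" "j < length vs"
  shows "concat (map (\<lambda>u. map (f u) vs) us) ! (length vs * i + j) = f (us ! i) (vs ! j)"
  using assms
proof (induction us arbitrary: i)
  case (Cons u us)
  then show ?case by (cases i) (auto simp: nth_append algebra_simps)
qed simp

lemma length_adj_matrix: "length (adj_matrix G vs) = length vs * length vs"
  by (simp add: adj_matrix_def length_concat comp_def sum_list_triv)

lemma length_encode_labeled:
  "length (encode_labeled code G lab vs) = 1 + (length vs + length vs * length vs)"
  by (simp add: encode_labeled_def length_adj_matrix)

lemma index_less_square: "u < n \<Longrightarrow> v < n \<Longrightarrow> n * u + v < n * (n :: nat)"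
  by (metis add.commute mult.commute mult_Suc mult_le_mono2 Suc_leI order_less_le_trans
      nat_add_left_cancel_less)

lemma encode_labeled_nth:
  assumes "u < length vs" "v < length vs"
  shows "encode_labeled code G lab vs ! (1 + u) = code (lab (vs ! u))"
    and "encode_labeled code G lab vs ! (1 + (length vs + (length vs * u + v))) =
      of_bool ((vs ! u, vs ! v) \<in> parcs G)"
  using assms nth_concat_map_map[OF assms, of "\<lambda>u v. if (u, v) \<in> parcs G then 1 else 0"]
  by (auto simp: encode_labeled_def nth_append adj_matrix_def)

text \<open>The memory cells read by \<open>valid\<close> hold matrix entries and label codes, and
  distinct enumerations make the passage from indices to nodes injective.\<close>

lemma bij_betw_valid_arc_pairs:
  assumes G: "pair_digraph G" and G': "pair_digraph G'"
    and vs: "enumerates vs G" and vs': "enumerates vs' G'"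
    and code: "inj_on code (lab ` pverts G \<union> lab' ` pverts G')"
    and M: "M = mem (start (encode_labeled code G lab vs @ encode_labeled code G' lab' vs'))"
  shows "bij_betw (\<lambda>((u, v), (u', v')). ((vs ! u, vs ! v), (vs' ! u', vs' ! v')))
    (set (filter (valid M (length vs) (length vs')) (quads (length vs) (length vs'))))
    (arc_pairs G lab G' lab')" (is "bij_betw ?f ?V _")
proof -
  interpret G: pair_digraph G by (rule G)
  interpret G': pair_digraph G' by (rule G')
  let ?n = "length vs" and ?m = "length vs'"
  let ?b = "1 + (?n + ?n * ?n)"
  have M1: "M i = encode_labeled code G lab vs ! i" if "i < ?b" for i
    using that by (simp add: M start_def length_encode_labeled nth_append)
  have M2: "M (?b + i) = encode_labeled code G' lab' vs' ! i" if "i < 1 + (?m + ?m * ?m)" for i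
    using that by (simp add: M start_def length_encode_labeled nth_append)
  have lab1: "M (1 + u) = code (lab (vs ! u))" if "u < ?n" for u
    using that M1[of "1 + u"] encode_labeled_nth(1)[of u vs u code G lab] by simp
  have lab2: "M (?b + (1 + u)) = code (lab' (vs' ! u))" if "u < ?m" for u
    using that M2[of "1 + u"] encode_labeled_nth(1)[of u vs' u code G' lab'] by simp
  have arc1: "M (1 + (?n + (?n * u + v))) = of_bool ((vs ! u, vs ! v) \<in> parcs G)"
    if "u < ?n" "v < ?n" for u v
    using index_less_square[OF that] M1[of "1 + (?n + (?n * u + v))"]
      encode_labeled_nth(2)[OF that, of code G lab] by simp
  have arc2: "M (?b + (1 + (?m + (?m * u + v)))) = of_bool ((vs' ! u, vs' ! v) \<in> parcs G')"
    if "u < ?m" "v < ?m" for u v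
    using index_less_square[OF that] M2[of "1 + (?m + (?m * u + v))"]
      encode_labeled_nth(2)[OF that, of code G' lab'] by simp
  \<comment> \<open>\<open>code\<close> is injective on the labels of both graphs together, so codes
    can be compared across the graphs.\<close>
  have code_eq: "code (lab (vs ! u)) = code (lab' (vs' ! u')) \<longleftrightarrow> lab (vs ! u) = lab' (vs' ! u')"
    if "u < ?n" "u' < ?m" for u u'
  proof -
    have "vs ! u \<in> pverts G" "vs' ! u' \<in> pverts G'"
      using that vs vs' unfolding enumerates_def by (metis nth_mem)+
    then show ?thesis
      by (intro inj_on_eq_iff[OF code]) auto
  qed
  have valid: "valid M ?n ?m ((u, v), (u', v')) \<longleftrightarrow>
      ((vs ! u, vs ! v), (vs' ! u', vs' ! v')) \<in> arc_pairs G lab G' lab'"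
    if "u < ?n" "v < ?n" "u' < ?m" "v' < ?m" for u v u' v'
    unfolding valid.simps Let_def arc1[OF that(1,2)] arc2[OF that(3,4)]
      lab1[OF that(1)] lab1[OF that(2)] lab2[OF that(3)] lab2[OF that(4)]
    by (simp add: arc_pairs_def code_eq that)
  have dist: "distinct vs" "distinct vs'"
    using vs vs' by (auto simp: enumerates_def)
  show ?thesis
    unfolding bij_betw_def
  proof
    show "inj_on ?f ?V"
      using dist by (auto simp: inj_on_def quads_def nth_eq_iff_index_eq simp del: valid.simps)
    show "?f ` ?V = arc_pairs G lab G' lab'"
    proof
      show "?f ` ?V \<subseteq> arc_pairs G lab G' lab'"
        using valid by (auto simp: quads_def simp del: valid.simps)
      show "arc_pairs G lab G' lab' \<subseteq> ?f ` ?V"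
      proof
        fix e assume e: "e \<in> arc_pairs G lab G' lab'"
        obtain a b a' b' where e_eq: "e = ((a, b), (a', b'))"
          by (metis surj_pair)
        then have "a \<in> set vs" "b \<in> set vs" "a' \<in> set vs'" "b' \<in> set vs'"
          using e vs vs' G.in_arcsD1 G.in_arcsD2 G'.in_arcsD1 G'.in_arcsD2
          unfolding arc_pairs_def enumerates_def by auto
        then obtain u v u' v' where "u < ?n" "v < ?n" "u' < ?m" "v' < ?m"
            "vs ! u = a" "vs ! v = b" "vs' ! u' = a'" "vs' ! v' = b'"
          by (metis in_set_conv_nth)
        then show "e \<in> ?f ` ?V"
          using e e_eq valid[of u v u' v']
          by (auto simp: quads_def image_iff simp del: valid.simps intro!: bexI[of _ "((u, v), (u', v'))"])
      qed
    qed
  qed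
qed

theorem theorem6p3:
  shows "\<exists>(prog :: com) (p :: nat poly).
    \<forall>(G :: 'a pair_pre_digraph) (lab :: 'a \<Rightarrow> 'l) (G' :: 'b pair_pre_digraph) (lab' :: 'b \<Rightarrow> 'l)
      (vs :: 'a list) (vs' :: 'b list) (code :: 'l \<Rightarrow> nat).
      pair_digraph G \<and> oriented G \<and> weakly_connected G \<and>
      pair_digraph G' \<and> oriented G' \<and> weakly_connected G' \<and>
      enumerates vs G \<and> enumerates vs' G' \<and>
      inj_on code (lab ` pverts G \<union> lab' ` pverts G')
      \<longrightarrow>
      (\<exists>(t :: nat) (H :: nat pair_pre_digraph) (ws :: nat list).
         outputs prog (encode_labeled code G lab vs @ encode_labeled code G' lab' vs')
           t (encode_unlabeled H ws) \<and>
         t \<le> poly p (card (pverts G) + card (pverts G')) \<and>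
         pair_graph H \<and> enumerates ws H \<and>
         max_clique_size H = DMCES G lab G' lab')"
proof (intro exI[of _ reduction_prog] exI[of _ reduction_time] allI impI, elim conjE)
  fix G :: "'a pair_pre_digraph" and lab :: "'a \<Rightarrow> 'l"
    and G' :: "'b pair_pre_digraph" and lab' :: "'b \<Rightarrow> 'l"
    and vs :: "'a list" and vs' :: "'b list" and code :: "'l \<Rightarrow> nat"
  assume G: "pair_digraph G" and G': "pair_digraph G'"
    and vs: "enumerates vs G" and vs': "enumerates vs' G'"
    and code: "inj_on code (lab ` pverts G \<union> lab' ` pverts G')"
  let ?input = "encode_labeled code G lab vs @ encode_labeled code G' lab' vs'"
  define M where "M = mem (start ?input)"
  define n where "n = length vs"
  define m where "m = length vs'"
  define qs where "qs = filter (valid M n m) (quads n m)"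
  define f where "f = (\<lambda>((u, v), (u', v')). ((vs ! u, vs ! v), (vs' ! u', vs' ! v')))"
  let ?N = "card (pverts G) + card (pverts G')"
  let ?H = "list_graph consistent qs"
  have n: "n = card (pverts G)" "M 0 = n" and m: "m = card (pverts G')" "M (1 + (n + n * n)) = m"
    using vs vs' distinct_card[of vs] distinct_card[of vs']
    by (auto simp: n_def m_def M_def enumerates_def start_def nth_append length_encode_labeled)
      (auto simp: encode_labeled_def)
  have "holds M [] [] [] (start ?input)"
    by (simp add: holds_def M_def start_def)
  then have "runs reduction_prog (poly reduction_time ?N) (start ?input)
      (\<lambda>s'. outp s' = sout M reduction [n, m])"
    using n m by (intro runs_reduction_prog) auto
  also have "sout M reduction [n, m] = encode_unlabeled ?H [0..<length qs]"
    unfolding encode_list_graph by (rule sout_reduction) (rule qs_def)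
  finally obtain t where t: "t \<le> poly reduction_time ?N"
      "outputs reduction_prog ?input t (encode_unlabeled ?H [0..<length qs])"
    unfolding runs_def outputs_def by blast
  have dist: "distinct vs" "distinct vs'"
    using vs vs' by (auto simp: enumerates_def)
  have "max_clique_size ?H = DMCES G lab G' lab'"
  proof (rule max_clique_size_list_graph[OF G G'])
    show "distinct qs"
      by (simp add: qs_def quads_def distinct_product)
    show "bij_betw f (set qs) (arc_pairs G lab G' lab')"
      unfolding qs_def f_def n_def m_def
      by (rule bij_betw_valid_arc_pairs[OF G G' vs vs' code M_def])
    \<comment> \<open>The program tests consistency on indices; this agrees with the test on nodes
      because \<open>consistent\<close> involves only equalities and \<open>vs\<close>,
      \<open>vs'\<close> are distinct.\<close>
    show "consistent p q \<longleftrightarrow> consistent (f p) (f q)" if "p \<in> set qs" "q \<in> set qs" for p q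
      using that dist
      by (cases "(p, q)" rule: consistent.cases)
        (auto simp: qs_def quads_def f_def n_def m_def nth_eq_iff_index_eq simp del: valid.simps)
  qed
  moreover have "pair_graph ?H"
    by (rule pair_graph_list_graph) (auto intro: consistent_sym simp: consistent_irrefl)
  moreover have "enumerates [0..<length qs] ?H"
    by (simp add: enumerates_def list_graph_def)
  ultimately show "\<exists>t (H :: nat pair_pre_digraph) ws. outputs reduction_prog ?input t (encode_unlabeled H ws) \<and>
      t \<le> poly reduction_time ?N \<and> pair_graph H \<and> enumerates ws H \<and>
      max_clique_size H = DMCES G lab G' lab'"
    using t by (intro exI[of _ t] exI[of _ ?H] exI[of _ "[0..<length qs]"] conjI)
qed

end
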